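(* Assume that there are no redundant actions for the experts and no redundant actions for the decision-maker in the game $\Gamma(\pi^\circ,u,v)$. If $\overline{u}$ is a concave function on $\Delta(\Omega)$, then the decision-maker does not benefit from cross-verification; that is, in all equilibria of $\Gamma(\pi^\circ,u,v)$ the decision-maker's payoff is $\overline{v}(\pi^\circ)$.
   Context: Notation. $\Omega$ (states) and $A$ (actions) are finite non-empty sets; $\pi^\circ\in\Delta(\Omega)$ is the common prior; $u,v:A\times\Omega\to\mathbb{R}$ are the payoff functions of the experts (both experts have the same payoff $u$) and of the decision-maker, respectively. $\Delta(X)$ is the set of (discrete) probability distributions on $X$. Payoffs are extended linearly: $u(\alpha,\pi)=\sum_{a,\omega}\alpha(a)\pi(\omega)u(a,\omega)$ for $\alpha\in\Delta(A)$, $\pi\in\Delta(\Omega)$, and likewise $v(\alpha,\pi)$. $BR(\pi)=\{\alpha\in\Delta(A): v(\alpha,\pi)\ge v(\alpha',\pi)\ \forall \alpha'\in\Delta(A)\}$. $\overline{u}(\pi)=\max_{\alpha\in BR(\pi)}u(\alpha,\pi)$ and $\overline{v}(\pi)=\max_{\alpha\in\Delta(A)}v(\alpha,\pi)$. Non-redundancy. $\hat A=\{a\in A:\exists \pi\in\Delta(\Omega)\text{ with }a\in BR(\pi)\}$. There are no redundant actions for the decision-maker if for every non-empty proper subset $B\subsetneq\hat A$ there is $\pi\in\Delta(\Omega)$ with $\overline v(\pi)>\max_{a\in B}v(a,\pi)$. There are no redundant actions for the experts if there are no two distinct actions $a,a'\in A$ with $u(a,\omega)=u(a',\omega)$ for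 all $\omega\in\Omega$. Experiments. A statistical experiment $\sigma$ is a partition of $\Omega\times[0,1]$ into finitely many Lebesgue measurable subsets, called signals. $\Sigma$ is the set of all experiments. The pair $(\omega,x)\in\Omega\times[0,1]$ is drawn from $\pi^\circ\times U[0,1]$, where $U[0,1]$ is uniform; the realized signal of $\sigma$ is the cell $s\in\sigma$ containing $(\omega,x)$. Hence the probability of $(s_1,s_2)\in\sigma_1\times\sigma_2$ conditional on $\omega$ is the Lebesgue measure of $\{x:(\omega,x)\in s_1\cap s_2\}$. Cheap-talk game $\Gamma(\pi^\circ,u,v)$. Stage 1: experts $1,2$ simultaneously choose experiments $\sigma_1,\sigma_2\in\Sigma$, which are publicly observed; then Nature draws $(\omega,x)$. Stage 2: expert $i$ privately observes his signal $s_i\in\sigma_i$ and (simultaneously with the other expert) sends a private message $m_i\in M_i$ to the decision-maker; the message set $M_i$ is rich enough to communicate any signal realization (for every experiment, its signals can be injectively encoded as messages in $M_i$). Stage 3: the decision-maker observes $(\sigma_1,\sigma_2,m_1,m_2)$, but not the signals, and chooses an action. A strategy of expert $i$ is $(\sigma_i,\tau_i)$ with $\sigma_i\in\Sigma$ and $\tau_i(\sigma_i,\sigma_j,s_i)\in\Delta(M_i)$; a strategy of the decision-maker is a map $\alpha$ giving $\alpha(\sigma_1,\sigma_2,m_1,m_2)\in\Delta(A)$. Each choice $(\sigma_1,\sigma_2)$ starts a proper sub-game. Equilibrium means weak perfect Bayesian equilibrium with beliefs consistent with the chosen experiments, also off path: for every $(\sigma_1,\sigma_2)$, (i) after each message pair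 the decision-maker holds a belief $\pi(m_1,m_2)\in\Delta(\Omega)$, given by Bayes' rule in the sub-game if $(m_1,m_2)$ has positive probability in that sub-game, and otherwise an arbitrary average of posteriors conditional on signal pairs $(s_1,s_2)$ of positive probability; (ii) the decision-maker plays a best-reply $\alpha(\sigma_1,\sigma_2,m_1,m_2)\in BR(\pi(m_1,m_2))$; (iii) each expert's message strategy is optimal at each signal of positive probability, given the other strategies; and (iv) at stage 1 no expert gains by choosing another experiment. *)

theory Defs
  imports "HOL-Probability.Probability"
begin

text \<open>
  States and actions are the elements of finite types, and distributions on them are vectors
  in the probability simplex, so that concavity is the library notion. Messages may range over
  an infinite type; distributions on them are of type \<^typ>\<open>'m pmf\<close>.
\<close>

definition prob_simplex :: "(real ^ 'n::finite) set" where
  "prob_simplex = {p. (\<forall>i. 0 \<le> p $ i) \<and> (\<Sum>i\<in>UNIV. p $ i) = 1}"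

abbreviation point_mass :: "'n::finite \<Rightarrow> real ^ 'n" where
  "point_mass i \<equiv> axis i 1"

definition payoff ::
  "('a::finite \<Rightarrow> 'w::finite \<Rightarrow> real) \<Rightarrow> real ^ 'a \<Rightarrow> real ^ 'w \<Rightarrow> real" where
  "payoff f \<alpha> \<pi> = (\<Sum>a\<in>UNIV. \<Sum>w\<in>UNIV. \<alpha> $ a * \<pi> $ w * f a w)"

definition BR :: "('a::finite \<Rightarrow> 'w::finite \<Rightarrow> real) \<Rightarrow> real ^ 'w \<Rightarrow> (real ^ 'a) set" where
  "BR v \<pi> = {\<alpha> \<in> prob_simplex. \<forall>\<alpha>'\<in>prob_simplex. payoff v \<alpha> \<pi> \<ge> payoff v \<alpha>' \<pi>}"

text \<open>The suprema below are maxima; see \<open>ubar_attained\<close> and \<open>vbar_attained\<close>.\<close>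

definition ubar ::
  "('a::finite \<Rightarrow> 'w::finite \<Rightarrow> real) \<Rightarrow> ('a \<Rightarrow> 'w \<Rightarrow> real) \<Rightarrow> real ^ 'w \<Rightarrow> real" where
  "ubar u v \<pi> = (SUP \<alpha>\<in>BR v \<pi>. payoff u \<alpha> \<pi>)"

definition vbar :: "('a::finite \<Rightarrow> 'w::finite \<Rightarrow> real) \<Rightarrow> real ^ 'w \<Rightarrow> real" where
  "vbar v \<pi> = (SUP \<alpha>\<in>prob_simplex. payoff v \<alpha> \<pi>)"

lemma compact_prob_simplex: "compact (prob_simplex :: (real ^ 'n::finite) set)"
proof -
  have "closed (prob_simplex :: (real ^ 'n) set)"
    unfolding prob_simplex_def
    by (intro closed_Collect_conj closed_Collect_all closed_Collect_le closed_Collect_eq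
        continuous_intros)
  moreover have "bounded (prob_simplex :: (real ^ 'n) set)"
    unfolding bounded_iff
  proof (intro exI[of _ 1] ballI)
    fix p :: "real ^ 'n" assume p: "p \<in> prob_simplex"
    have "norm p \<le> (\<Sum>i\<in>UNIV. \<bar>p $ i\<bar>)"
      by (rule norm_le_l1_cart)
    also have "\<dots> = 1"
      using p by (simp add: prob_simplex_def)
    finally show "norm p \<le> 1" .
  qed
  ultimately show ?thesis
    by (simp add: compact_eq_bounded_closed)
qed

lemma point_mass_in_prob_simplex: "point_mass i \<in> prob_simplex"
  by (simp add: prob_simplex_def axis_def)

lemma continuous_on_payoff: "continuous_on S (\<lambda>\<alpha>. payoff f \<alpha> \<pi>)"
  unfolding payoff_def by (intro continuous_intros)

lemma vbar_attained: "\<exists>\<alpha>\<in>BR v \<pi>. vbar v \<pi> = payoff v \<alpha> \<pi>"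
proof -
  have "prob_simplex \<noteq> {}"
    using point_mass_in_prob_simplex by blast
  from continuous_attains_sup[OF compact_prob_simplex this continuous_on_payoff]
  obtain \<alpha> where \<alpha>: "\<alpha> \<in> prob_simplex"
      "\<forall>\<alpha>'\<in>prob_simplex. payoff v \<alpha>' \<pi> \<le> payoff v \<alpha> \<pi>"
    by (rule bexE)
  have "vbar v \<pi> = payoff v \<alpha> \<pi>"
    unfolding vbar_def
  proof (rule cSup_eq_maximum)
    show "payoff v \<alpha> \<pi> \<in> (\<lambda>\<alpha>. payoff v \<alpha> \<pi>) ` prob_simplex"
      using \<alpha>(1) by (rule imageI)
    show "x \<le> payoff v \<alpha> \<pi>" if "x \<in> (\<lambda>\<alpha>. payoff v \<alpha> \<pi>) ` prob_simplex" for x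
      using that \<alpha>(2) by (elim imageE) simp
  qed
  moreover have "\<alpha> \<in> BR v \<pi>"
    unfolding BR_def using \<alpha> by simp
  ultimately show ?thesis
    by (rule bexI)
qed

lemma ubar_attained: "\<exists>\<alpha>\<in>BR v \<pi>. ubar u v \<pi> = payoff u \<alpha> \<pi>"
proof -
  have "BR v \<pi> = prob_simplex \<inter>
      (\<Inter>\<alpha>'\<in>prob_simplex. {\<alpha>. payoff v \<alpha>' \<pi> \<le> payoff v \<alpha> \<pi>})"
    by (intro set_eqI) (simp add: BR_def)
  also have "compact \<dots>"
    by (intro compact_Int_closed compact_prob_simplex closed_INT ballI closed_Collect_le
        continuous_on_const continuous_on_payoff)
  finally have "compact (BR v \<pi>)" .
  moreover have "BR v \<pi> \<noteq> {}"
    using vbar_attained[of v \<pi>] by blast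
  ultimately have "\<exists>\<alpha>\<in>BR v \<pi>. \<forall>\<alpha>'\<in>BR v \<pi>. payoff u \<alpha>' \<pi> \<le> payoff u \<alpha> \<pi>"
    by (rule continuous_attains_sup) (rule continuous_on_payoff)
  then obtain \<alpha> where \<alpha>: "\<alpha> \<in> BR v \<pi>"
      "\<forall>\<alpha>'\<in>BR v \<pi>. payoff u \<alpha>' \<pi> \<le> payoff u \<alpha> \<pi>"
    by (rule bexE)
  have "ubar u v \<pi> = payoff u \<alpha> \<pi>"
    unfolding ubar_def
  proof (rule cSup_eq_maximum)
    show "payoff u \<alpha> \<pi> \<in> (\<lambda>\<alpha>. payoff u \<alpha> \<pi>) ` BR v \<pi>"
      using \<alpha>(1) by (rule imageI)
    show "x \<le> payoff u \<alpha> \<pi>" if "x \<in> (\<lambda>\<alpha>. payoff u \<alpha> \<pi>) ` BR v \<pi>" for x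
      using that \<alpha>(2) by (elim imageE) simp
  qed
  then show ?thesis
    using \<alpha>(1) by (rule bexI)
qed

definition A_hat :: "('a::finite \<Rightarrow> 'w::finite \<Rightarrow> real) \<Rightarrow> 'a set" where
  "A_hat v = {a. \<exists>\<pi>\<in>prob_simplex. point_mass a \<in> BR v \<pi>}"

definition no_redundant_dm :: "('a::finite \<Rightarrow> 'w::finite \<Rightarrow> real) \<Rightarrow> bool" where
  "no_redundant_dm v \<longleftrightarrow> (\<forall>B. B \<noteq> {} \<and> B \<subset> A_hat v \<longrightarrow>
     (\<exists>\<pi>\<in>prob_simplex. vbar v \<pi> > Max ((\<lambda>a. payoff v (point_mass a) \<pi>) ` B)))"

definition no_redundant_experts :: "('a::finite \<Rightarrow> 'w::finite \<Rightarrow> real) \<Rightarrow> bool" where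
  "no_redundant_experts u \<longleftrightarrow> \<not> (\<exists>a a'. a \<noteq> a' \<and> (\<forall>w. u a w = u a' w))"

type_synonym 'w signal = "('w \<times> real) set"
type_synonym 'w stat_experiment = "'w signal set"

text \<open>As the state space is finite, a subset of \<open>\<Omega> \<times> [0,1]\<close> is measurable iff all its
  sections are.\<close>

definition experiments :: "'w::finite stat_experiment set" where
  "experiments = {\<sigma>. finite \<sigma> \<and> partition_on (UNIV \<times> {0..1}) \<sigma> \<and>
     (\<forall>s\<in>\<sigma>. \<forall>w. Pair w -` s \<in> sets lebesgue)}"

definition signals_prob :: "real ^ 'w::finite \<Rightarrow> 'w signal \<Rightarrow> 'w signal \<Rightarrow> 'w \<Rightarrow> real" where
  "signals_prob \<pi>0 s1 s2 w = \<pi>0 $ w * measure lebesgue (Pair w -` (s1 \<inter> s2))"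

definition signal_prob :: "real ^ 'w::finite \<Rightarrow> 'w signal \<Rightarrow> real" where
  "signal_prob \<pi>0 s = (\<Sum>w\<in>UNIV. \<pi>0 $ w * measure lebesgue (Pair w -` s))"

definition posterior :: "real ^ 'w::finite \<Rightarrow> 'w signal \<Rightarrow> 'w signal \<Rightarrow> real ^ 'w" where
  "posterior \<pi>0 s1 s2 =
     (\<chi> w. signals_prob \<pi>0 s1 s2 w / (\<Sum>w'\<in>UNIV. signals_prob \<pi>0 s1 s2 w'))"

text \<open>
  From here on \<open>t1\<close>, \<open>t2\<close>, \<open>act\<close> and \<open>bel\<close> are the experts' messages, the decision-maker's
  action and his belief inside the sub-game that starts with the experiments \<open>\<sigma>1\<close>, \<open>\<sigma>2\<close>.
\<close>

definition messages_prob ::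
  "real ^ 'w::finite \<Rightarrow> 'w stat_experiment \<Rightarrow> 'w stat_experiment \<Rightarrow> ('w signal \<Rightarrow> 'm1 pmf) \<Rightarrow>
   ('w signal \<Rightarrow> 'm2 pmf) \<Rightarrow> 'm1 \<Rightarrow> 'm2 \<Rightarrow> 'w \<Rightarrow> real" where
  "messages_prob \<pi>0 \<sigma>1 \<sigma>2 t1 t2 m1 m2 w =
     (\<Sum>s1\<in>\<sigma>1. \<Sum>s2\<in>\<sigma>2. signals_prob \<pi>0 s1 s2 w * pmf (t1 s1) m1 * pmf (t2 s2) m2)"

definition consistent_beliefs ::
  "real ^ 'w::finite \<Rightarrow> 'w stat_experiment \<Rightarrow> 'w stat_experiment \<Rightarrow> ('w signal \<Rightarrow> 'm1 pmf) \<Rightarrow>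
   ('w signal \<Rightarrow> 'm2 pmf) \<Rightarrow> ('m1 \<Rightarrow> 'm2 \<Rightarrow> real ^ 'w) \<Rightarrow> bool" where
  "consistent_beliefs \<pi>0 \<sigma>1 \<sigma>2 t1 t2 bel \<longleftrightarrow> (\<forall>m1 m2.
     let p = (\<lambda>w. messages_prob \<pi>0 \<sigma>1 \<sigma>2 t1 t2 m1 m2 w) in
     if (\<Sum>w\<in>UNIV. p w) > 0
     then bel m1 m2 = (\<chi> w. p w / (\<Sum>w'\<in>UNIV. p w'))
     else bel m1 m2 \<in> convex hull {posterior \<pi>0 s1 s2 | s1 s2.
            s1 \<in> \<sigma>1 \<and> s2 \<in> \<sigma>2 \<and> (\<Sum>w\<in>UNIV. signals_prob \<pi>0 s1 s2 w) > 0})"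

definition talk_payoff ::
  "('a::finite \<Rightarrow> 'w::finite \<Rightarrow> real) \<Rightarrow> ('m1 \<Rightarrow> 'm2 \<Rightarrow> real ^ 'a) \<Rightarrow> 'm1 pmf \<Rightarrow> 'm2 pmf \<Rightarrow>
   'w \<Rightarrow> real" where
  "talk_payoff f act q1 q2 w =
     measure_pmf.expectation (pair_pmf q1 q2) (\<lambda>(m1, m2). payoff f (act m1 m2) (point_mass w))"

definition subgame_payoff ::
  "real ^ 'w::finite \<Rightarrow> ('a::finite \<Rightarrow> 'w \<Rightarrow> real) \<Rightarrow> 'w stat_experiment \<Rightarrow> 'w stat_experiment \<Rightarrow>
   ('w signal \<Rightarrow> 'm1 pmf) \<Rightarrow> ('w signal \<Rightarrow> 'm2 pmf) \<Rightarrow> ('m1 \<Rightarrow> 'm2 \<Rightarrow> real ^ 'a) \<Rightarrow> real" where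
  "subgame_payoff \<pi>0 f \<sigma>1 \<sigma>2 t1 t2 act =
     (\<Sum>s1\<in>\<sigma>1. \<Sum>s2\<in>\<sigma>2. \<Sum>w\<in>UNIV.
        signals_prob \<pi>0 s1 s2 w * talk_payoff f act (t1 s1) (t2 s2) w)"

definition expert1_payoff_at ::
  "real ^ 'w::finite \<Rightarrow> ('a::finite \<Rightarrow> 'w \<Rightarrow> real) \<Rightarrow> 'w stat_experiment \<Rightarrow> ('w signal \<Rightarrow> 'm2 pmf) \<Rightarrow>
   ('m1 \<Rightarrow> 'm2 \<Rightarrow> real ^ 'a) \<Rightarrow> 'w signal \<Rightarrow> 'm1 pmf \<Rightarrow> real" where
  "expert1_payoff_at \<pi>0 u \<sigma>2 t2 act s1 q =
     (\<Sum>s2\<in>\<sigma>2. \<Sum>w\<in>UNIV.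
        signals_prob \<pi>0 s1 s2 w / signal_prob \<pi>0 s1 * talk_payoff u act q (t2 s2) w)"

definition expert2_payoff_at ::
  "real ^ 'w::finite \<Rightarrow> ('a::finite \<Rightarrow> 'w \<Rightarrow> real) \<Rightarrow> 'w stat_experiment \<Rightarrow> ('w signal \<Rightarrow> 'm1 pmf) \<Rightarrow>
   ('m1 \<Rightarrow> 'm2 \<Rightarrow> real ^ 'a) \<Rightarrow> 'w signal \<Rightarrow> 'm2 pmf \<Rightarrow> real" where
  "expert2_payoff_at \<pi>0 u \<sigma>1 t1 act s2 q =
     (\<Sum>s1\<in>\<sigma>1. \<Sum>w\<in>UNIV.
        signals_prob \<pi>0 s1 s2 w / signal_prob \<pi>0 s2 * talk_payoff u act (t1 s1) q w)"

definition subgame_equilibrium ::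
  "real ^ 'w::finite \<Rightarrow> ('a::finite \<Rightarrow> 'w \<Rightarrow> real) \<Rightarrow> ('a \<Rightarrow> 'w \<Rightarrow> real) \<Rightarrow>
   'w stat_experiment \<Rightarrow> 'w stat_experiment \<Rightarrow> ('w signal \<Rightarrow> 'm1 pmf) \<Rightarrow> ('w signal \<Rightarrow> 'm2 pmf) \<Rightarrow>
   ('m1 \<Rightarrow> 'm2 \<Rightarrow> real ^ 'a) \<Rightarrow> ('m1 \<Rightarrow> 'm2 \<Rightarrow> real ^ 'w) \<Rightarrow> bool" where
  "subgame_equilibrium \<pi>0 u v \<sigma>1 \<sigma>2 t1 t2 act bel \<longleftrightarrow>
     consistent_beliefs \<pi>0 \<sigma>1 \<sigma>2 t1 t2 bel \<and>
     (\<forall>m1 m2. act m1 m2 \<in> BR v (bel m1 m2)) \<and>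
     (\<forall>s1\<in>\<sigma>1. signal_prob \<pi>0 s1 > 0 \<longrightarrow> (\<forall>q.
        expert1_payoff_at \<pi>0 u \<sigma>2 t2 act s1 q \<le> expert1_payoff_at \<pi>0 u \<sigma>2 t2 act s1 (t1 s1))) \<and>
     (\<forall>s2\<in>\<sigma>2. signal_prob \<pi>0 s2 > 0 \<longrightarrow> (\<forall>q.
        expert2_payoff_at \<pi>0 u \<sigma>1 t1 act s2 q \<le> expert2_payoff_at \<pi>0 u \<sigma>1 t1 act s2 (t2 s2)))"

text \<open>
  Expert \<open>i\<close>'s message strategy \<open>\<tau>i\<close> takes his own experiment first, whereas \<open>\<alpha>\<close> and the
  belief system \<open>\<mu>\<close> take expert 1's experiment first.
\<close>

type_synonym ('w, 'm) message_strategy = "'w stat_experiment \<Rightarrow> 'w stat_experiment \<Rightarrow> 'w signal \<Rightarrow> 'm pmf"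

definition equilibrium ::
  "real ^ 'w::finite \<Rightarrow> ('a::finite \<Rightarrow> 'w \<Rightarrow> real) \<Rightarrow> ('a \<Rightarrow> 'w \<Rightarrow> real) \<Rightarrow>
   'w stat_experiment \<Rightarrow> ('w, 'm1) message_strategy \<Rightarrow>
   'w stat_experiment \<Rightarrow> ('w, 'm2) message_strategy \<Rightarrow>
   ('w stat_experiment \<Rightarrow> 'w stat_experiment \<Rightarrow> 'm1 \<Rightarrow> 'm2 \<Rightarrow> real ^ 'a) \<Rightarrow>
   ('w stat_experiment \<Rightarrow> 'w stat_experiment \<Rightarrow> 'm1 \<Rightarrow> 'm2 \<Rightarrow> real ^ 'w) \<Rightarrow> bool" where
  "equilibrium \<pi>0 u v \<sigma>1 \<tau>1 \<sigma>2 \<tau>2 \<alpha> \<mu> \<longleftrightarrow>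
     \<sigma>1 \<in> experiments \<and> \<sigma>2 \<in> experiments \<and>
     (\<forall>\<rho>1\<in>experiments. \<forall>\<rho>2\<in>experiments.
        subgame_equilibrium \<pi>0 u v \<rho>1 \<rho>2 (\<tau>1 \<rho>1 \<rho>2) (\<tau>2 \<rho>2 \<rho>1) (\<alpha> \<rho>1 \<rho>2) (\<mu> \<rho>1 \<rho>2)) \<and>
     (\<forall>\<rho>1\<in>experiments.
        subgame_payoff \<pi>0 u \<rho>1 \<sigma>2 (\<tau>1 \<rho>1 \<sigma>2) (\<tau>2 \<sigma>2 \<rho>1) (\<alpha> \<rho>1 \<sigma>2)
          \<le> subgame_payoff \<pi>0 u \<sigma>1 \<sigma>2 (\<tau>1 \<sigma>1 \<sigma>2) (\<tau>2 \<sigma>2 \<sigma>1) (\<alpha> \<sigma>1 \<sigma>2)) \<and>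
     (\<forall>\<rho>2\<in>experiments.
        subgame_payoff \<pi>0 u \<sigma>1 \<rho>2 (\<tau>1 \<sigma>1 \<rho>2) (\<tau>2 \<rho>2 \<sigma>1) (\<alpha> \<sigma>1 \<rho>2)
          \<le> subgame_payoff \<pi>0 u \<sigma>1 \<sigma>2 (\<tau>1 \<sigma>1 \<sigma>2) (\<tau>2 \<sigma>2 \<sigma>1) (\<alpha> \<sigma>1 \<sigma>2))"

end

theory Submission
  imports Defs
begin

text \<open>
  The two non-redundancy assumptions and the concavity of \<open>ubar\<close> make the experts and the
  decision-maker opponents: \<open>ubar\<close> is the minimum of the functions \<open>u a\<close>, \<open>a \<in> A_hat v\<close>, and the
  decision-maker's pure best replies are exactly the minimizers. So if \<open>a\<close> is optimal at the
  prior, the experts cannot get more than \<open>u a\<close> at the prior, that is \<open>ubar \<pi>0\<close>. They do not get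
  less either: expert 1 can deviate to an uninformative experiment, after which expert 2 can
  ignore his signal. Equality forces \<open>a\<close> to be a best reply after every message pair of positive
  probability, so the decision-maker does no better than by always playing \<open>a\<close>.
\<close>

subsection \<open>Payoffs and best replies\<close>

lemma prob_simplexD:
  assumes "p \<in> prob_simplex"
  shows "0 \<le> p $ i" "(\<Sum>i\<in>UNIV. p $ i) = 1"
  using assms by (auto simp: prob_simplex_def)

lemma convex_prob_simplex: "convex (prob_simplex :: (real ^ 'n::finite) set)"
  by (rule convexI) (auto simp: prob_simplex_def sum.distrib simp flip: sum_distrib_left)

lemma payoff_point_mass: "payoff f (point_mass a) \<pi> = (\<Sum>w\<in>UNIV. \<pi> $ w * f a w)"
proof -
  have "payoff f (point_mass a) \<pi> = (\<Sum>b\<in>UNIV. if b = a then \<Sum>w\<in>UNIV. \<pi> $ w * f a w else 0)"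
    unfolding payoff_def by (rule sum.cong) (auto simp: axis_def)
  then show ?thesis
    by simp
qed

lemma payoff_point_mass2: "payoff f (point_mass a) (point_mass w) = f a w"
proof -
  have "payoff f (point_mass a) (point_mass w) = (\<Sum>w'\<in>UNIV. if w' = w then f a w else 0)"
    unfolding payoff_point_mass by (rule sum.cong) (auto simp: axis_def)
  then show ?thesis
    by simp
qed

lemma payoff_sum_actions: "payoff f \<alpha> \<pi> = (\<Sum>a\<in>UNIV. \<alpha> $ a * payoff f (point_mass a) \<pi>)"
  unfolding payoff_point_mass unfolding payoff_def
  by (simp add: sum_distrib_left mult.assoc)

lemma payoff_sum_states: "payoff f \<alpha> \<pi> = (\<Sum>w\<in>UNIV. \<pi> $ w * payoff f \<alpha> (point_mass w))"
proof -
  have "payoff f \<alpha> (point_mass w) = (\<Sum>a\<in>UNIV. \<alpha> $ a * f a w)" for w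
    by (subst payoff_sum_actions) (simp add: payoff_point_mass2)
  then show ?thesis
    unfolding payoff_def by (subst sum.swap) (simp add: sum_distrib_left ac_simps)
qed

lemma payoff_combine:
  "payoff f \<alpha> (s *\<^sub>R p + t *\<^sub>R q) = s * payoff f \<alpha> p + t * payoff f \<alpha> q"
  unfolding payoff_def by (simp add: sum.distrib sum_distrib_left algebra_simps)

text \<open>The payoff is an average over the support of the action, so bounding the pure actions of
  positive weight suffices. With \<open>payoff_ge\<close> this reduces claims about mixed actions to
  pure ones.\<close>

lemma payoff_le:
  assumes "\<alpha> \<in> prob_simplex" "\<And>a. 0 < \<alpha> $ a \<Longrightarrow> payoff f (point_mass a) \<pi> \<le> c"
  shows "payoff f \<alpha> \<pi> \<le> c"
proof -
  have "payoff f \<alpha> \<pi> \<le> (\<Sum>a\<in>UNIV. \<alpha> $ a * c)"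
    unfolding payoff_sum_actions[of f \<alpha>]
  proof (rule sum_mono)
    show "\<alpha> $ a * payoff f (point_mass a) \<pi> \<le> \<alpha> $ a * c" for a
      using assms(2)[of a] prob_simplexD(1)[OF assms(1), of a]
      by (cases "0 < \<alpha> $ a") auto
  qed
  also have "\<dots> = c"
    using prob_simplexD(2)[OF assms(1)] by (simp flip: sum_distrib_right)
  finally show ?thesis .
qed

lemma payoff_ge:
  assumes "\<alpha> \<in> prob_simplex" "\<And>a. 0 < \<alpha> $ a \<Longrightarrow> c \<le> payoff f (point_mass a) \<pi>"
  shows "c \<le> payoff f \<alpha> \<pi>"
proof -
  have "(\<Sum>a\<in>UNIV. \<alpha> $ a * c) \<le> payoff f \<alpha> \<pi>"
    unfolding payoff_sum_actions[of f \<alpha>]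
  proof (rule sum_mono)
    show "\<alpha> $ a * c \<le> \<alpha> $ a * payoff f (point_mass a) \<pi>" for a
      using assms(2)[of a] prob_simplexD(1)[OF assms(1), of a]
      by (cases "0 < \<alpha> $ a") auto
  qed
  then show ?thesis
    using prob_simplexD(2)[OF assms(1)] by (simp flip: sum_distrib_right)
qed

lemma payoff_BR: "\<alpha> \<in> BR v \<pi> \<Longrightarrow> payoff v \<alpha> \<pi> = vbar v \<pi>"
  using vbar_attained[of v \<pi>] by (force simp: BR_def)

lemma point_mass_BR_iff:
  "point_mass a \<in> BR v \<pi> \<longleftrightarrow> (\<forall>b. payoff v (point_mass b) \<pi> \<le> payoff v (point_mass a) \<pi>)"
  by (auto simp: BR_def point_mass_in_prob_simplex intro: payoff_le)

text \<open>The shortfalls of the pure actions from the optimal value are nonnegative and average to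
  zero under \<open>\<alpha>\<close>, so each one of positive weight vanishes.\<close>

lemma BR_support:
  assumes \<alpha>: "\<alpha> \<in> BR v \<pi>" and pos: "0 < \<alpha> $ a"
  shows "point_mass a \<in> BR v \<pi>"
proof -
  have s: "\<alpha> \<in> prob_simplex"
    using \<alpha> by (simp add: BR_def)
  have le: "payoff v (point_mass b) \<pi> \<le> payoff v \<alpha> \<pi>" for b
    using \<alpha> point_mass_in_prob_simplex by (auto simp: BR_def)
  have "(\<Sum>b\<in>UNIV. \<alpha> $ b * (payoff v \<alpha> \<pi> - payoff v (point_mass b) \<pi>)) = 0"
    using prob_simplexD(2)[OF s]
    by (simp add: right_diff_distrib sum_subtractf flip: sum_distrib_right payoff_sum_actions)
  then have "\<alpha> $ a * (payoff v \<alpha> \<pi> - payoff v (point_mass a) \<pi>) = 0"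
    using le prob_simplexD(1)[OF s] by (subst (asm) sum_nonneg_eq_0_iff) auto
  with pos le show ?thesis
    by (simp add: point_mass_BR_iff)
qed

lemma ex_point_mass_BR: "\<exists>a. point_mass a \<in> BR v \<pi>"
proof -
  obtain \<alpha> where \<alpha>: "\<alpha> \<in> BR v \<pi>"
    using vbar_attained by blast
  then have s: "\<alpha> \<in> prob_simplex"
    by (simp add: BR_def)
  obtain a where "\<alpha> $ a \<noteq> 0"
    using prob_simplexD(2)[OF s] by (metis sum.neutral zero_neq_one)
  then show ?thesis
    using BR_support[OF \<alpha>] prob_simplexD(1)[OF s, of a] by (auto simp: less_le)
qed

lemma payoff_le_ubar:
  assumes "\<alpha> \<in> BR v \<pi>"
  shows "payoff u \<alpha> \<pi> \<le> ubar u v \<pi>"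
  unfolding ubar_def
proof (rule cSUP_upper[OF assms])
  \<comment> \<open>A real supremum is an upper bound only of a set that is bounded above;
    compactness of the simplex supplies this.\<close>
  have "bdd_above ((\<lambda>\<alpha>. payoff u \<alpha> \<pi>) ` prob_simplex)"
    by (intro bounded_imp_bdd_above compact_imp_bounded compact_continuous_image
        continuous_on_payoff compact_prob_simplex)
  then show "bdd_above ((\<lambda>\<alpha>. payoff u \<alpha> \<pi>) ` BR v \<pi>)"
    by (rule bdd_above_mono) (auto simp: BR_def)
qed

lemma A_hatI: "point_mass a \<in> BR v \<pi> \<Longrightarrow> \<pi> \<in> prob_simplex \<Longrightarrow> a \<in> A_hat v"
  by (auto simp: A_hat_def)

text \<open>By \<open>BR_support\<close> every best reply puts all its weight on \<open>a\<close>,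
  so the maximum in \<open>ubar\<close> has nothing to choose from.\<close>

lemma ubar_unique_BR:
  assumes "\<And>b. b \<noteq> a \<Longrightarrow> payoff v (point_mass b) \<pi> < payoff v (point_mass a) \<pi>"
  shows "ubar u v \<pi> = payoff u (point_mass a) \<pi>"
proof (rule antisym)
  obtain \<alpha> where \<alpha>: "\<alpha> \<in> BR v \<pi>" "ubar u v \<pi> = payoff u \<alpha> \<pi>"
    using ubar_attained by blast
  have only: "b = a" if "0 < \<alpha> $ b" for b
    using BR_support[OF \<alpha>(1) that] assms[of b] by (metis point_mass_BR_iff linorder_not_le)
  show "ubar u v \<pi> \<le> payoff u (point_mass a) \<pi>"
    unfolding \<alpha>(2)
  proof (rule payoff_le)
    show "\<alpha> \<in> prob_simplex"
      using \<alpha>(1) by (simp add: BR_def)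
    show "payoff u (point_mass b) \<pi> \<le> payoff u (point_mass a) \<pi>" if "0 < \<alpha> $ b" for b
      unfolding only[OF that] by (rule order.refl)
  qed
  have "point_mass a \<in> BR v \<pi>"
    unfolding point_mass_BR_iff by (metis assms order.refl less_imp_le)
  then show "payoff u (point_mass a) \<pi> \<le> ubar u v \<pi>"
    by (rule payoff_le_ubar)
qed

subsection \<open>Non-redundant actions and a concave \<open>ubar\<close>\<close>

text \<open>Non-redundancy, applied to \<open>A_hat v\<close> without \<open>a\<close>, yields a
  belief at which every other action of \<open>A_hat v\<close> misses the optimum.\<close>

lemma unique_BR_exists:
  assumes dm: "no_redundant_dm v" and a: "a \<in> A_hat v"
  obtains \<pi> where "\<pi> \<in> prob_simplex"
    "\<And>b. b \<noteq> a \<Longrightarrow> payoff v (point_mass b) \<pi> < payoff v (point_mass a) \<pi>"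
proof -
  obtain \<pi> where \<pi>: "\<pi> \<in> prob_simplex"
    and less: "\<And>b. b \<in> A_hat v - {a} \<Longrightarrow> payoff v (point_mass b) \<pi> < vbar v \<pi>"
  \<comment> \<open>Non-redundancy speaks of non-empty sets only; if \<open>a\<close> is alone in
    \<open>A_hat v\<close>, any belief serves.\<close>
  proof (cases "A_hat v - {a} = {}")
    case True
    then show ?thesis
      by (intro that[OF point_mass_in_prob_simplex]) blast
  next
    case False
    moreover have "A_hat v - {a} \<subset> A_hat v"
      using a by blast
    ultimately obtain \<pi> where "\<pi> \<in> prob_simplex" and
        "Max ((\<lambda>b. payoff v (point_mass b) \<pi>) ` (A_hat v - {a})) < vbar v \<pi>"
      using dm[unfolded no_redundant_dm_def, rule_format, of "A_hat v - {a}"] by metis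
    then have "payoff v (point_mass b) \<pi> < vbar v \<pi>" if "b \<in> A_hat v - {a}" for b
      using that Max_ge[of "(\<lambda>b. payoff v (point_mass b) \<pi>) ` (A_hat v - {a})"]
      by (meson finite finite_imageI image_eqI le_less_trans)
    with \<open>\<pi> \<in> prob_simplex\<close> show ?thesis
      by (rule that)
  qed
  have only: "b = a" if "point_mass b \<in> BR v \<pi>" for b
    using that less[of b] payoff_BR[OF that] A_hatI[OF that \<pi>] by (cases "b = a") auto
  then have "point_mass a \<in> BR v \<pi>"
    using ex_point_mass_BR by metis
  \<comment> \<open>Strictness: an action that ties with \<open>a\<close> would be a second best
    reply.\<close>
  then have "payoff v (point_mass b) \<pi> < payoff v (point_mass a) \<pi>" if "b \<noteq> a" for b
    using only[of b] that unfolding point_mass_BR_iff by (meson linorder_not_le order_trans)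
  with \<pi> show ?thesis
    by (rule that)
qed

text \<open>Finitely many strict inequalities, continuous in \<open>t\<close>, hold at
  \<open>t = 0\<close> and so persist for small positive \<open>t\<close>.\<close>

lemma unique_BR_near:
  assumes "\<And>b. b \<noteq> a \<Longrightarrow> payoff v (point_mass b) p < payoff v (point_mass a) p"
  obtains t where "0 < t" "t < 1"
    "\<And>b. b \<noteq> a \<Longrightarrow> payoff v (point_mass b) ((1 - t) *\<^sub>R p + t *\<^sub>R q)
                       < payoff v (point_mass a) ((1 - t) *\<^sub>R p + t *\<^sub>R q)"
proof -
  have "eventually (\<lambda>t. \<forall>b\<in>-{a}. payoff v (point_mass b) ((1 - t) *\<^sub>R p + t *\<^sub>R q)
                       < payoff v (point_mass a) ((1 - t) *\<^sub>R p + t *\<^sub>R q)) (at_right 0)"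
  proof (intro eventually_ball_finite ballI)
    fix b assume "b \<in> -{a}"
    define d where "d t = payoff v (point_mass a) ((1 - t) *\<^sub>R p + t *\<^sub>R q)
        - payoff v (point_mass b) ((1 - t) *\<^sub>R p + t *\<^sub>R q)" for t
    have "(d \<longlongrightarrow> d 0) (at_right 0)"
      unfolding d_def payoff_combine by (intro tendsto_intros)
    moreover have "0 < d 0"
      using assms[of b] \<open>b \<in> -{a}\<close> by (simp add: d_def)
    ultimately have "eventually (\<lambda>t. 0 < d t) (at_right 0)"
      by (rule order_tendstoD)
    then show "eventually (\<lambda>t. payoff v (point_mass b) ((1 - t) *\<^sub>R p + t *\<^sub>R q)
                       < payoff v (point_mass a) ((1 - t) *\<^sub>R p + t *\<^sub>R q)) (at_right 0)"
      by (rule eventually_mono) (simp add: d_def)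
  qed simp
  moreover have "eventually (\<lambda>t. t \<in> {0<..<1}) (at_right (0::real))"
    by (rule eventually_at_right_real) simp
  ultimately have "eventually (\<lambda>t. t \<in> {0<..<1} \<and>
      (\<forall>b\<in>-{a}. payoff v (point_mass b) ((1 - t) *\<^sub>R p + t *\<^sub>R q)
                       < payoff v (point_mass a) ((1 - t) *\<^sub>R p + t *\<^sub>R q))) (at_right 0)"
    by eventually_elim auto
  then show ?thesis
    using that by (fastforce dest: eventually_happens)
qed

text \<open>Near a belief where \<open>a\<close> is the unique best reply, \<open>ubar\<close> coincides with the linear function
  \<open>u a\<close>, so the latter is a supergradient.\<close>

lemma ubar_le_payoff:
  assumes dm: "no_redundant_dm v" and conc: "concave_on prob_simplex (ubar u v)"
    and a: "a \<in> A_hat v" and \<pi>: "\<pi> \<in> prob_simplex"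
  shows "ubar u v \<pi> \<le> payoff u (point_mass a) \<pi>"
proof -
  obtain p where p: "p \<in> prob_simplex"
      "\<And>b. b \<noteq> a \<Longrightarrow> payoff v (point_mass b) p < payoff v (point_mass a) p"
    using unique_BR_exists[OF dm a] by blast
  obtain t where t: "0 < t" "t < 1"
      "\<And>b. b \<noteq> a \<Longrightarrow> payoff v (point_mass b) ((1 - t) *\<^sub>R p + t *\<^sub>R \<pi>)
                       < payoff v (point_mass a) ((1 - t) *\<^sub>R p + t *\<^sub>R \<pi>)"
    using unique_BR_near[OF p(2)] by blast
  \<comment> \<open>Both at \<open>p\<close> and at the mixture, \<open>ubar\<close> is the payoff
    of \<open>a\<close>; the terms at \<open>p\<close> therefore cancel and \<open>t > 0\<close> can
    be divided out.\<close>
  have "(1 - t) * ubar u v p + t * ubar u v \<pi> \<le> ubar u v ((1 - t) *\<^sub>R p + t *\<^sub>R \<pi>)"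
    using conc t p(1) \<pi> by (simp add: concave_on_iff)
  also have "\<dots> = (1 - t) * payoff u (point_mass a) p + t * payoff u (point_mass a) \<pi>"
    using ubar_unique_BR[OF t(3)] by (simp add: payoff_combine)
  finally show ?thesis
    using t(1) ubar_unique_BR[OF p(2)] by simp
qed

text \<open>Each pure action in the support lies in \<open>A_hat v\<close> and gives the experts at
  least \<open>ubar\<close>, while a best reply gives at most \<open>ubar\<close>. Hence
  tie-breaking by the decision-maker does not affect the experts.\<close>

lemma payoff_BR_eq_ubar:
  assumes "no_redundant_dm v" "concave_on prob_simplex (ubar u v)"
    and "\<pi> \<in> prob_simplex" "\<alpha> \<in> BR v \<pi>"
  shows "payoff u \<alpha> \<pi> = ubar u v \<pi>"
proof (rule antisym)
  show "payoff u \<alpha> \<pi> \<le> ubar u v \<pi>"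
    by (rule payoff_le_ubar) fact
  show "ubar u v \<pi> \<le> payoff u \<alpha> \<pi>"
  proof (rule payoff_ge)
    show "\<alpha> \<in> prob_simplex"
      using assms(4) by (simp add: BR_def)
    show "ubar u v \<pi> \<le> payoff u (point_mass a) \<pi>" if "0 < \<alpha> $ a" for a
      by (rule ubar_le_payoff[OF assms(1,2) A_hatI[OF BR_support[OF assms(4) that] assms(3)] assms(3)])
  qed
qed

text \<open>If \<open>u a\<close> and \<open>u b\<close> met at a belief where \<open>a\<close> is the unique best reply, then \<open>u a \<le> u b\<close> on the
  whole simplex, with equality at the belief where \<open>b\<close> is the unique best reply; exchanging the
  roles, \<open>u a = u b\<close>.\<close>

lemma payoff_less_at_unique_BR:
  assumes dm: "no_redundant_dm v" and conc: "concave_on prob_simplex (ubar u v)"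
    and ex: "no_redundant_experts u"
    and ab: "a \<in> A_hat v" "b \<in> A_hat v" "b \<noteq> a"
    and p: "p \<in> prob_simplex"
      "\<And>b. b \<noteq> a \<Longrightarrow> payoff v (point_mass b) p < payoff v (point_mass a) p"
  shows "payoff u (point_mass a) p < payoff u (point_mass b) p"
proof (rule ccontr)
  \<comment> \<open>Slightly away from \<open>r\<close> towards \<open>q\<close>, the payoff of
    \<open>c\<close> is still \<open>ubar\<close>, hence at most that of \<open>d\<close>. At
    \<open>r\<close> it is at least that of \<open>d\<close>, so by linearity it is at most that of
    \<open>d\<close> at \<open>q\<close>.\<close>
  have global: "payoff u (point_mass c) q \<le> payoff u (point_mass d) q"
    if "d \<in> A_hat v" "q \<in> prob_simplex" "r \<in> prob_simplex"
      and r: "\<And>b. b \<noteq> c \<Longrightarrow> payoff v (point_mass b) r < payoff v (point_mass c) r"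
        "payoff u (point_mass d) r \<le> payoff u (point_mass c) r" for c d q r
  proof -
    obtain t where t: "0 < t" "t < 1"
        "\<And>b. b \<noteq> c \<Longrightarrow> payoff v (point_mass b) ((1 - t) *\<^sub>R r + t *\<^sub>R q)
                         < payoff v (point_mass c) ((1 - t) *\<^sub>R r + t *\<^sub>R q)"
      using unique_BR_near[OF r(1)] by blast
    have "(1 - t) *\<^sub>R r + t *\<^sub>R q \<in> prob_simplex"
      using that t by (intro convexD[OF convex_prob_simplex]) auto
    moreover have "ubar u v ((1 - t) *\<^sub>R r + t *\<^sub>R q)
        = payoff u (point_mass c) ((1 - t) *\<^sub>R r + t *\<^sub>R q)"
      by (rule ubar_unique_BR) (rule t(3))
    ultimately have "(1 - t) * payoff u (point_mass c) r + t * payoff u (point_mass c) q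
        \<le> (1 - t) * payoff u (point_mass d) r + t * payoff u (point_mass d) q"
      using ubar_le_payoff[OF dm conc \<open>d \<in> A_hat v\<close>] by (metis payoff_combine)
    moreover have "(1 - t) * payoff u (point_mass d) r \<le> (1 - t) * payoff u (point_mass c) r"
      using r(2) t by (intro mult_left_mono) auto
    ultimately have "t * payoff u (point_mass c) q \<le> t * payoff u (point_mass d) q"
      by linarith
    then show ?thesis
      using t by simp
  qed
  assume "\<not> payoff u (point_mass a) p < payoff u (point_mass b) p"
  then have 1: "payoff u (point_mass a) q \<le> payoff u (point_mass b) q" if "q \<in> prob_simplex" for q
    using global[of b q p a] that ab p by auto
  \<comment> \<open>At \<open>r\<close> the roles of \<open>a\<close> and \<open>b\<close> can be
    exchanged: fact \<open>1\<close> supplies the inequality that \<open>global\<close> asks for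
    there.\<close>
  obtain r where r: "r \<in> prob_simplex"
      "\<And>c. c \<noteq> b \<Longrightarrow> payoff v (point_mass c) r < payoff v (point_mass b) r"
    using unique_BR_exists[OF dm ab(2)] by blast
  have 2: "payoff u (point_mass b) q \<le> payoff u (point_mass a) q" if "q \<in> prob_simplex" for q
    using global[OF ab(1) that r] 1[OF r(1)] by simp
  have "u a w = u b w" for w
    using 1 2 point_mass_in_prob_simplex[of w] by (fastforce simp: payoff_point_mass2)
  with ab(3) ex show False
    unfolding no_redundant_experts_def by metis
qed

text \<open>If some \<open>c\<close> beat \<open>a\<close> at \<open>\<pi>\<close>, it would still
  do so at a belief \<open>q\<close> slightly closer to the belief \<open>p\<close> where
  \<open>a\<close> is the unique best reply. A best reply \<open>b\<close> at \<open>q\<close> gives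
  the experts at most what \<open>a\<close> gives, yet at least as much at \<open>\<pi>\<close> and
  strictly more at \<open>p\<close>, against linearity.\<close>

lemma BR_if_payoff_eq_ubar:
  assumes dm: "no_redundant_dm v" and conc: "concave_on prob_simplex (ubar u v)"
    and ex: "no_redundant_experts u"
    and a: "a \<in> A_hat v" and \<pi>: "\<pi> \<in> prob_simplex"
    and eq: "payoff u (point_mass a) \<pi> = ubar u v \<pi>"
  shows "point_mass a \<in> BR v \<pi>"
  unfolding point_mass_BR_iff
proof (rule allI, rule ccontr)
  fix c
  assume "\<not> payoff v (point_mass c) \<pi> \<le> payoff v (point_mass a) \<pi>"
  then have less: "payoff v (point_mass a) \<pi> < payoff v (point_mass c) \<pi>"
    by simp
  obtain p where p: "p \<in> prob_simplex"
      "\<And>b. b \<noteq> a \<Longrightarrow> payoff v (point_mass b) p < payoff v (point_mass a) p"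
    using unique_BR_exists[OF dm a] by blast
  define d where "d t = payoff v (point_mass c) ((1 - t) *\<^sub>R \<pi> + t *\<^sub>R p)
      - payoff v (point_mass a) ((1 - t) *\<^sub>R \<pi> + t *\<^sub>R p)" for t
  have "(d \<longlongrightarrow> d 0) (at_right 0)"
    unfolding d_def payoff_combine by (intro tendsto_intros)
  moreover have "0 < d 0"
    using less by (simp add: d_def)
  ultimately have "eventually (\<lambda>t. 0 < d t) (at_right 0)"
    by (rule order_tendstoD)
  moreover have "eventually (\<lambda>t. t \<in> {0<..<1}) (at_right (0::real))"
    by (rule eventually_at_right_real) simp
  ultimately have "eventually (\<lambda>t. t \<in> {0<..<1} \<and> 0 < d t) (at_right 0)"
    by eventually_elim auto
  then obtain t where t: "0 < t" "t < 1" "0 < d t"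
    by (fastforce dest: eventually_happens)
  define q where "q = (1 - t) *\<^sub>R \<pi> + t *\<^sub>R p"
  have q: "q \<in> prob_simplex"
    unfolding q_def using t p \<pi> by (intro convexD[OF convex_prob_simplex]) auto
  obtain b where b: "point_mass b \<in> BR v q"
    using ex_point_mass_BR by blast
  have bA: "b \<in> A_hat v"
    using A_hatI[OF b q] .
  have "b \<noteq> a"
    using b t(3) unfolding point_mass_BR_iff d_def q_def by (metis diff_gt_0_iff_gt linorder_not_le)
  have "payoff u (point_mass b) q \<le> payoff u (point_mass a) q"
    using payoff_le_ubar[OF b, of u] ubar_le_payoff[OF dm conc a q] by linarith
  \<comment> \<open>The strict inequality at \<open>p\<close> survives in the mixture because its
    weight \<open>t\<close> is positive.\<close>
  moreover have "t * payoff u (point_mass a) p < t * payoff u (point_mass b) p"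
    using payoff_less_at_unique_BR[OF dm conc ex a bA \<open>b \<noteq> a\<close> p] t by simp
  moreover have "(1 - t) * payoff u (point_mass a) \<pi> \<le> (1 - t) * payoff u (point_mass b) \<pi>"
    using eq ubar_le_payoff[OF dm conc bA \<pi>] t by (intro mult_left_mono) auto
  ultimately show False
    unfolding q_def payoff_combine by linarith
qed

subsection \<open>Payoffs in a sub-game\<close>

text \<open>The cells of \<open>\<sigma>\<close> cut each section of \<open>s\<close> into finitely
  many disjoint pieces, and the measure is additive.\<close>

lemma experiments_Int_measure_sum:
  assumes \<sigma>: "\<sigma> \<in> experiments" and \<rho>: "\<rho> \<in> experiments" and s: "s \<in> \<rho>"
  shows "(\<Sum>s'\<in>\<sigma>. measure lebesgue (Pair w -` (s \<inter> s'))) = measure lebesgue (Pair w -` s)"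
proof -
  have fin: "finite \<sigma>" and part: "partition_on (UNIV \<times> {0..1}) \<sigma>"
    and meas: "\<And>s. s \<in> \<sigma> \<Longrightarrow> Pair w -` s \<in> sets lebesgue"
    using \<sigma> by (auto simp: experiments_def)
  have sub: "s \<subseteq> UNIV \<times> {0..1}" and smeas: "Pair w -` s \<in> sets lebesgue"
    using \<rho> s by (auto simp: experiments_def partition_on_def)
  have "measure lebesgue (\<Union>s'\<in>\<sigma>. Pair w -` (s \<inter> s'))
      = (\<Sum>s'\<in>\<sigma>. measure lebesgue (Pair w -` (s \<inter> s')))"
  proof (rule measure_UNION')
    show "Pair w -` (s \<inter> s') \<in> lmeasurable" if "s' \<in> \<sigma>" for s'
    \<comment> \<open>Additivity of \<open>measure\<close> needs finite measure, which boundedness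
      of the sections provides.\<close>
    proof (rule bounded_set_imp_lmeasurable)
      show "bounded (Pair w -` (s \<inter> s'))"
        by (rule bounded_subset[OF bounded_closed_interval[of 0 "1 :: real"]]) (use sub in auto)
      show "Pair w -` (s \<inter> s') \<in> sets lebesgue"
        using meas[OF that] smeas by simp
    qed
    show "pairwise (\<lambda>i j. disjnt (Pair w -` (s \<inter> i)) (Pair w -` (s \<inter> j))) \<sigma>"
    proof (rule pairwiseI)
      fix i j assume "i \<in> \<sigma>" "j \<in> \<sigma>" "i \<noteq> j"
      then have "i \<inter> j = {}"
        using part by (simp add: partition_on_def disjoint_def)
      then show "disjnt (Pair w -` (s \<inter> i)) (Pair w -` (s \<inter> j))"
        by (auto simp: disjnt_def)
    qed
  qed fact
  moreover have "(\<Union>s'\<in>\<sigma>. Pair w -` (s \<inter> s')) = Pair w -` (s \<inter> \<Union>\<sigma>)"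
    by auto
  moreover have "s \<inter> \<Union>\<sigma> = s"
    using part sub by (simp add: partition_on_def Int_absorb2)
  ultimately show ?thesis
    by simp
qed

text \<open>A single cell reveals nothing about the state; this is the deviation of expert 1 that
  bounds the experts' payoff from below.\<close>

lemma trivial_experiment: "{UNIV \<times> {0..1}} \<in> experiments"
proof -
  have "Pair w -` (UNIV \<times> {0..1::real}) = {0..1}" for w :: 'a
    by auto
  then show ?thesis
    unfolding experiments_def by (simp add: partition_on_def) force
qed

lemma signals_prob_sum2:
  assumes "\<sigma>2 \<in> experiments" "\<sigma>1 \<in> experiments" "s1 \<in> \<sigma>1"
  shows "(\<Sum>s2\<in>\<sigma>2. signals_prob \<pi>0 s1 s2 w) = \<pi>0 $ w * measure lebesgue (Pair w -` s1)"
  unfolding signals_prob_def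
  by (simp add: experiments_Int_measure_sum[OF assms] del: vimage_Int flip: sum_distrib_left)

lemma signals_prob_sum1:
  assumes "\<sigma>1 \<in> experiments" "\<sigma>2 \<in> experiments" "s2 \<in> \<sigma>2"
  shows "(\<Sum>s1\<in>\<sigma>1. signals_prob \<pi>0 s1 s2 w) = \<pi>0 $ w * measure lebesgue (Pair w -` s2)"
  using signals_prob_sum2[OF assms, of \<pi>0 w] by (simp add: signals_prob_def Int_commute)

lemma signals_prob_trivial_sum:
  assumes "\<sigma> \<in> experiments"
  shows "(\<Sum>s\<in>\<sigma>. signals_prob \<pi>0 (UNIV \<times> {0..1}) s w) = \<pi>0 $ w"
proof -
  have "Pair w -` (UNIV \<times> {0..1::real}) = {0..1}"
    by auto
  then show ?thesis
    using signals_prob_sum2[OF assms trivial_experiment, of _ \<pi>0 w] by simp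
qed

text \<open>Summing out \<open>\<sigma>2\<close> leaves the probabilities of the signals in
  \<open>\<sigma>1\<close>, which are those obtained when \<open>\<sigma>1\<close> is paired with
  the uninformative experiment.\<close>

lemma signals_prob_total:
  assumes \<sigma>1: "\<sigma>1 \<in> experiments" and \<sigma>2: "\<sigma>2 \<in> experiments"
  shows "(\<Sum>s1\<in>\<sigma>1. \<Sum>s2\<in>\<sigma>2. signals_prob \<pi>0 s1 s2 w) = \<pi>0 $ w"
proof -
  have "(\<Sum>s1\<in>\<sigma>1. \<Sum>s2\<in>\<sigma>2. signals_prob \<pi>0 s1 s2 w)
      = (\<Sum>s1\<in>\<sigma>1. \<pi>0 $ w * measure lebesgue (Pair w -` s1))"
    using signals_prob_sum2[OF \<sigma>2 \<sigma>1] by simp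
  also have "\<dots> = (\<Sum>s1\<in>\<sigma>1. signals_prob \<pi>0 (UNIV \<times> {0..1}) s1 w)"
  proof (rule sum.cong)
    fix s1 assume "s1 \<in> \<sigma>1"
    then have "s1 \<subseteq> UNIV \<times> {0..1}"
      using \<sigma>1 by (auto simp: experiments_def partition_on_def)
    then show "\<pi>0 $ w * measure lebesgue (Pair w -` s1) = signals_prob \<pi>0 (UNIV \<times> {0..1}) s1 w"
      by (simp add: signals_prob_def Int_absorb1)
  qed simp
  finally show ?thesis
    by (simp add: signals_prob_trivial_sum[OF \<sigma>1])
qed

section \<open>Expected payoffs as integrals over message pairs\<close>

text \<open>The bound is uniform in the action, which makes payoffs integrable even over infinitely
  many messages.\<close>

lemma abs_payoff_le:
  assumes "\<alpha> \<in> prob_simplex"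
  shows "\<bar>payoff f \<alpha> \<pi>\<bar> \<le> (\<Sum>a\<in>UNIV. \<bar>payoff f (point_mass a) \<pi>\<bar>)"
proof -
  have le: "\<bar>payoff f (point_mass a) \<pi>\<bar> \<le> (\<Sum>a\<in>UNIV. \<bar>payoff f (point_mass a) \<pi>\<bar>)" for a
    by (rule member_le_sum) auto
  show ?thesis
  proof (rule abs_leI)
    show "payoff f \<alpha> \<pi> \<le> (\<Sum>a\<in>UNIV. \<bar>payoff f (point_mass a) \<pi>\<bar>)"
      using assms by (rule payoff_le) (use le abs_le_D1 in blast)
    have "- (\<Sum>a\<in>UNIV. \<bar>payoff f (point_mass a) \<pi>\<bar>) \<le> payoff f \<alpha> \<pi>"
      using assms by (rule payoff_ge) (use le abs_le_D2 minus_le_iff in blast)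
    then show "- payoff f \<alpha> \<pi> \<le> (\<Sum>a\<in>UNIV. \<bar>payoff f (point_mass a) \<pi>\<bar>)"
      by simp
  qed
qed

text \<open>Passing from the message distributions to counting measure puts all signal pairs on one
  common measure, so that their integrals can be added.\<close>

lemma talk_payoff_integral:
  assumes "\<And>m1 m2. act m1 m2 \<in> prob_simplex"
  shows "integrable (count_space UNIV) (\<lambda>m. pmf q1 (fst m) * pmf q2 (snd m)
            * payoff f (act (fst m) (snd m)) (point_mass w))" (is "integrable _ ?g")
    and "talk_payoff f act q1 q2 w = (LINT m|count_space UNIV.
            pmf q1 (fst m) * pmf q2 (snd m) * payoff f (act (fst m) (snd m)) (point_mass w))"
proof -
  let ?h = "\<lambda>m. payoff f (act (fst m) (snd m)) (point_mass w)"
  have pm: "pmf (pair_pmf q1 q2) m = pmf q1 (fst m) * pmf q2 (snd m)" for m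
    by (cases m) (simp add: pmf_pair)
  have "integrable (measure_pmf (pair_pmf q1 q2)) ?h"
    by (rule measure_pmf.integrable_const_bound
        [where B = "\<Sum>a\<in>UNIV. \<bar>payoff f (point_mass a) (point_mass w)\<bar>"])
       (auto intro: abs_payoff_le[OF assms])
  then show "integrable (count_space UNIV) ?g"
    by (simp add: measure_pmf_eq_density integrable_density pm)
  show "talk_payoff f act q1 q2 w = integral\<^sup>L (count_space UNIV) ?g"
    by (simp add: talk_payoff_def case_prod_beta measure_pmf_eq_density integral_density pm)
qed

text \<open>Exchanging the finite sums over signals and states with the integral collects, for each
  message pair, its joint probability with every state. In this form Bayes' rule applies pair by
  pair.\<close>

lemma subgame_payoff_integral:
  fixes act :: "'m1 \<Rightarrow> 'm2 \<Rightarrow> real ^ 'a::finite" and \<pi>0 :: "real ^ 'w::finite"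
    and t1 :: "'w signal \<Rightarrow> 'm1 pmf" and t2 :: "'w signal \<Rightarrow> 'm2 pmf" and \<sigma>1 \<sigma>2
  assumes "\<And>m1 m2. act m1 m2 \<in> prob_simplex"
  defines "g \<equiv> \<lambda>f m. \<Sum>w\<in>UNIV. messages_prob \<pi>0 \<sigma>1 \<sigma>2 t1 t2 (fst m) (snd m) w
        * payoff f (act (fst m) (snd m)) (point_mass w)"
  shows "integrable (count_space UNIV) (g f)"
    and "subgame_payoff \<pi>0 f \<sigma>1 \<sigma>2 t1 t2 act = integral\<^sup>L (count_space UNIV) (g f)"
proof -
  note talk = talk_payoff_integral[OF assms(1)]
  have g: "g f = (\<lambda>m. \<Sum>s1\<in>\<sigma>1. \<Sum>s2\<in>\<sigma>2. \<Sum>w\<in>UNIV. signals_prob \<pi>0 s1 s2 w *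
      (pmf (t1 s1) (fst m) * pmf (t2 s2) (snd m) * payoff f (act (fst m) (snd m)) (point_mass w)))"
    (is "_ = (\<lambda>m. \<Sum>s1\<in>\<sigma>1. \<Sum>s2\<in>\<sigma>2. \<Sum>w\<in>UNIV. ?h s1 s2 w m)")
  proof
    fix m
    have "g f m = (\<Sum>w\<in>UNIV. \<Sum>s1\<in>\<sigma>1. \<Sum>s2\<in>\<sigma>2. ?h s1 s2 w m)"
      by (simp add: g_def messages_prob_def sum_distrib_right mult.assoc)
    also have "\<dots> = (\<Sum>s1\<in>\<sigma>1. \<Sum>w\<in>UNIV. \<Sum>s2\<in>\<sigma>2. ?h s1 s2 w m)"
      by (rule sum.swap)
    also have "\<dots> = (\<Sum>s1\<in>\<sigma>1. \<Sum>s2\<in>\<sigma>2. \<Sum>w\<in>UNIV. ?h s1 s2 w m)"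
      by (intro sum.cong sum.swap refl)
    finally show "g f m = \<dots>" .
  qed
  have int: "integrable (count_space UNIV) (?h s1 s2 w)" for s1 s2 w
    by (intro integrable_mult_right talk(1))
  show "integrable (count_space UNIV) (g f)"
    unfolding g by (intro Bochner_Integration.integrable_sum int)
  show "subgame_payoff \<pi>0 f \<sigma>1 \<sigma>2 t1 t2 act = integral\<^sup>L (count_space UNIV) (g f)"
    unfolding g subgame_payoff_def using int
    by (simp add: Bochner_Integration.integral_sum talk(2))
qed

section \<open>Beliefs and Bayes' rule\<close>

lemma signals_prob_nonneg: "\<pi>0 \<in> prob_simplex \<Longrightarrow> 0 \<le> signals_prob \<pi>0 s1 s2 w"
  by (simp add: signals_prob_def prob_simplexD)

lemma messages_prob_nonneg:
  "\<pi>0 \<in> prob_simplex \<Longrightarrow> 0 \<le> messages_prob \<pi>0 \<sigma>1 \<sigma>2 t1 t2 m1 m2 w"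
  by (auto simp: messages_prob_def signals_prob_nonneg intro!: sum_nonneg)

lemma normalize_in_prob_simplex:
  fixes p :: "'w::finite \<Rightarrow> real"
  assumes "\<And>w. 0 \<le> p w" "0 < (\<Sum>w\<in>UNIV. p w)"
  shows "(\<chi> w. p w / (\<Sum>w'\<in>UNIV. p w')) \<in> prob_simplex"
  using assms by (auto simp: prob_simplex_def simp flip: sum_divide_distrib)

text \<open>On path the belief is a normalized nonnegative vector; off path it is a mixture of
  posteriors, and the simplex is convex.\<close>

lemma belief_in_prob_simplex:
  assumes prior: "\<pi>0 \<in> prob_simplex" and cons: "consistent_beliefs \<pi>0 \<sigma>1 \<sigma>2 t1 t2 bel"
  shows "bel m1 m2 \<in> prob_simplex"
proof -
  let ?p = "\<lambda>w. messages_prob \<pi>0 \<sigma>1 \<sigma>2 t1 t2 m1 m2 w"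
  let ?S = "{posterior \<pi>0 s1 s2 | s1 s2.
            s1 \<in> \<sigma>1 \<and> s2 \<in> \<sigma>2 \<and> (\<Sum>w\<in>UNIV. signals_prob \<pi>0 s1 s2 w) > 0}"
  have c: "if (\<Sum>w\<in>UNIV. ?p w) > 0 then bel m1 m2 = (\<chi> w. ?p w / (\<Sum>w'\<in>UNIV. ?p w'))
      else bel m1 m2 \<in> convex hull ?S"
    using cons unfolding consistent_beliefs_def Let_def by blast
  show ?thesis
  proof (cases "(\<Sum>w\<in>UNIV. ?p w) > 0")
    case True
    with c show ?thesis
      using normalize_in_prob_simplex[OF messages_prob_nonneg[OF prior] True] by simp
  next
    case False
    have "?S \<subseteq> prob_simplex"
      unfolding posterior_def
      by (auto intro!: normalize_in_prob_simplex signals_prob_nonneg[OF prior])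
    then have "convex hull ?S \<subseteq> prob_simplex"
      by (intro hull_minimal convex_prob_simplex)
    with c False show ?thesis
      by auto
  qed
qed

text \<open>For a pair of positive probability this is Bayes' rule multiplied out; otherwise both
  sides are zero, whatever the off-path belief.\<close>

lemma messages_payoff_belief:
  assumes prior: "\<pi>0 \<in> prob_simplex" and cons: "consistent_beliefs \<pi>0 \<sigma>1 \<sigma>2 t1 t2 bel"
  shows "(\<Sum>w\<in>UNIV. messages_prob \<pi>0 \<sigma>1 \<sigma>2 t1 t2 m1 m2 w * payoff f \<alpha> (point_mass w))
       = (\<Sum>w\<in>UNIV. messages_prob \<pi>0 \<sigma>1 \<sigma>2 t1 t2 m1 m2 w) * payoff f \<alpha> (bel m1 m2)"
proof (cases "(\<Sum>w\<in>UNIV. messages_prob \<pi>0 \<sigma>1 \<sigma>2 t1 t2 m1 m2 w) > 0")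
  case True
  let ?P = "\<Sum>w\<in>UNIV. messages_prob \<pi>0 \<sigma>1 \<sigma>2 t1 t2 m1 m2 w"
  have "bel m1 m2 = (\<chi> w. messages_prob \<pi>0 \<sigma>1 \<sigma>2 t1 t2 m1 m2 w / ?P)"
    using cons True unfolding consistent_beliefs_def Let_def by presburger
  with True show ?thesis
    by (subst (2) payoff_sum_states) (simp add: sum_distrib_left)
next
  case False
  then have "(\<Sum>w\<in>UNIV. messages_prob \<pi>0 \<sigma>1 \<sigma>2 t1 t2 m1 m2 w) = 0"
    using sum_nonneg[of UNIV "messages_prob \<pi>0 \<sigma>1 \<sigma>2 t1 t2 m1 m2"] messages_prob_nonneg[OF prior]
    by (meson antisym_conv2 not_le)
  moreover from this have "messages_prob \<pi>0 \<sigma>1 \<sigma>2 t1 t2 m1 m2 w = 0" for w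
    by (subst (asm) sum_nonneg_eq_0_iff) (auto simp: messages_prob_nonneg[OF prior])
  ultimately show ?thesis
    by simp
qed

section \<open>Payoff comparisons in sub-game equilibria\<close>

text \<open>A constant action makes messages irrelevant, and the signal probabilities sum to the
  prior. The lemma evaluates the benchmark in which one action is always played.\<close>

lemma subgame_payoff_const:
  assumes "\<sigma>1 \<in> experiments" "\<sigma>2 \<in> experiments"
  shows "subgame_payoff \<pi>0 f \<sigma>1 \<sigma>2 t1 t2 (\<lambda>_ _. \<alpha>) = payoff f \<alpha> \<pi>0"
proof -
  have "subgame_payoff \<pi>0 f \<sigma>1 \<sigma>2 t1 t2 (\<lambda>_ _. \<alpha>)
      = (\<Sum>s1\<in>\<sigma>1. \<Sum>s2\<in>\<sigma>2. \<Sum>w\<in>UNIV. signals_prob \<pi>0 s1 s2 w * payoff f \<alpha> (point_mass w))"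
    by (simp add: subgame_payoff_def talk_payoff_def case_prod_unfold)
  also have "\<dots> = (\<Sum>s1\<in>\<sigma>1. \<Sum>w\<in>UNIV. \<Sum>s2\<in>\<sigma>2. signals_prob \<pi>0 s1 s2 w * payoff f \<alpha> (point_mass w))"
    by (intro sum.cong sum.swap refl)
  also have "\<dots> = (\<Sum>w\<in>UNIV. \<Sum>s1\<in>\<sigma>1. \<Sum>s2\<in>\<sigma>2. signals_prob \<pi>0 s1 s2 w * payoff f \<alpha> (point_mass w))"
    by (rule sum.swap)
  also have "\<dots> = (\<Sum>w\<in>UNIV. \<pi>0 $ w * payoff f \<alpha> (point_mass w))"
    using signals_prob_total[OF assms, of \<pi>0] by (simp flip: sum_distrib_right)
  finally show ?thesis
    by (simp flip: payoff_sum_states)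
qed

text \<open>If expert 2 always sends the same message \<open>k\<close>, the reply is independent of the state, and it
  mixes actions in \<open>A_hat v\<close>, none of which gives the experts less than \<open>ubar\<close> at the prior.\<close>

lemma ubar_le_subgame_payoff_trivial:
  fixes t1 :: "'w::finite signal \<Rightarrow> 'm1 pmf" and t2 :: "'w signal \<Rightarrow> 'm2 pmf"
  assumes prior: "\<pi>0 \<in> prob_simplex"
    and dm: "no_redundant_dm v" and conc: "concave_on prob_simplex (ubar u v)"
    and \<sigma>: "\<sigma> \<in> experiments"
    and eq: "subgame_equilibrium \<pi>0 u v {UNIV \<times> {0..1}} \<sigma> t1 t2 act bel"
  shows "ubar u v \<pi>0 \<le> subgame_payoff \<pi>0 u {UNIV \<times> {0..1}} \<sigma> t1 t2 act"
proof -
  let ?T = "UNIV \<times> {0..1} :: 'w signal"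
  have cons: "consistent_beliefs \<pi>0 {?T} \<sigma> t1 t2 bel"
    and act: "\<And>m1 m2. act m1 m2 \<in> BR v (bel m1 m2)"
    and opt: "\<And>s q. s \<in> \<sigma> \<Longrightarrow> 0 < signal_prob \<pi>0 s \<Longrightarrow>
        expert2_payoff_at \<pi>0 u {?T} t1 act s q \<le> expert2_payoff_at \<pi>0 u {?T} t1 act s (t2 s)"
    using eq unfolding subgame_equilibrium_def by auto
  have act_simplex: "\<And>m1 m2. act m1 m2 \<in> prob_simplex"
    using act by (auto simp: BR_def)
  \<comment> \<open>Any fixed message serves; \<open>undefined\<close> merely names one.\<close>
  define k :: 'm2 where "k = undefined"
  \<comment> \<open>This is optimality at \<open>s\<close> multiplied by the probability of
    \<open>s\<close>; for a signal of probability zero both sides vanish.\<close>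
  have dev: "(\<Sum>w\<in>UNIV. signals_prob \<pi>0 ?T s w * talk_payoff u act (t1 ?T) (return_pmf k) w)
      \<le> (\<Sum>w\<in>UNIV. signals_prob \<pi>0 ?T s w * talk_payoff u act (t1 ?T) (t2 s) w)"
    if s: "s \<in> \<sigma>" for s
  proof -
    have sum: "(\<Sum>w\<in>UNIV. signals_prob \<pi>0 ?T s w) = signal_prob \<pi>0 s"
      using signals_prob_sum1[OF trivial_experiment \<sigma> s, of \<pi>0] by (simp add: signal_prob_def)
    have nn: "0 \<le> signal_prob \<pi>0 s"
      unfolding sum[symmetric] by (intro sum_nonneg signals_prob_nonneg prior)
    show ?thesis
    proof (cases "signal_prob \<pi>0 s = 0")
      case True
      then have "signals_prob \<pi>0 ?T s w = 0" for w
        using sum sum_nonneg_eq_0_iff[of UNIV "signals_prob \<pi>0 ?T s"]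
        by (simp add: signals_prob_nonneg[OF prior])
      then show ?thesis
        by simp
    next
      case False
      with nn have pos: "0 < signal_prob \<pi>0 s"
        by simp
      from opt[OF s pos, of "return_pmf k"] pos show ?thesis
        by (simp add: expert2_payoff_at_def divide_right_mono divide_le_cancel
            flip: sum_divide_distrib)
    qed
  qed
  have "ubar u v \<pi>0 \<le> payoff u (act m k) \<pi>0" for m
    using act_simplex
  proof (rule payoff_ge)
    fix a assume "0 < act m k $ a"
    then have "a \<in> A_hat v"
      using act BR_support A_hatI belief_in_prob_simplex[OF prior cons] by metis
    then show "ubar u v \<pi>0 \<le> payoff u (point_mass a) \<pi>0"
      by (rule ubar_le_payoff[OF dm conc _ prior])
  qed
  moreover have int: "integrable (measure_pmf (t1 ?T)) (\<lambda>m. payoff u (act m k) \<pi>)" for \<pi>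
    by (rule measure_pmf.integrable_const_bound
        [where B = "\<Sum>a\<in>UNIV. \<bar>payoff u (point_mass a) \<pi>\<bar>"])
       (auto intro: abs_payoff_le[OF act_simplex])
  ultimately have "ubar u v \<pi>0 \<le> (LINT m|t1 ?T. payoff u (act m k) \<pi>0)"
    by (intro measure_pmf.integral_ge_const) auto
  also have "\<dots> = (\<Sum>w\<in>UNIV. \<pi>0 $ w * (LINT m|t1 ?T. payoff u (act m k) (point_mass w)))"
    using int by (subst payoff_sum_states) (simp add: Bochner_Integration.integral_sum)
  also have "\<dots> = (\<Sum>w\<in>UNIV. \<pi>0 $ w * talk_payoff u act (t1 ?T) (return_pmf k) w)"
    by (simp add: talk_payoff_def pair_return_pmf2)
  \<comment> \<open>The prior is split over expert 2's signals, so that \<open>dev\<close> can be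
    applied signal by signal.\<close>
  also have "\<dots> = (\<Sum>w\<in>UNIV. \<Sum>s\<in>\<sigma>. signals_prob \<pi>0 ?T s w
      * talk_payoff u act (t1 ?T) (return_pmf k) w)"
    using signals_prob_trivial_sum[OF \<sigma>, of \<pi>0] by (simp flip: sum_distrib_right)
  also have "\<dots> = (\<Sum>s\<in>\<sigma>. \<Sum>w\<in>UNIV. signals_prob \<pi>0 ?T s w
      * talk_payoff u act (t1 ?T) (return_pmf k) w)"
    by (rule sum.swap)
  also have "\<dots> \<le> (\<Sum>s\<in>\<sigma>. \<Sum>w\<in>UNIV. signals_prob \<pi>0 ?T s w
      * talk_payoff u act (t1 ?T) (t2 s) w)"
    by (intro sum_mono dev)
  finally show ?thesis
    by (simp add: subgame_payoff_def)
qed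

text \<open>After every message pair the experts would weakly gain if \<open>a\<close>, optimal at
  the prior, were played instead. On average they cannot gain, so the gain is zero at each pair of
  positive probability and \<open>a\<close> is a best reply there.\<close>

lemma dm_payoff_eq_vbar:
  assumes prior: "\<pi>0 \<in> prob_simplex"
    and dm: "no_redundant_dm v" and conc: "concave_on prob_simplex (ubar u v)"
    and ex: "no_redundant_experts u"
    and \<sigma>: "\<sigma>1 \<in> experiments" "\<sigma>2 \<in> experiments"
    and eq: "subgame_equilibrium \<pi>0 u v \<sigma>1 \<sigma>2 t1 t2 act bel"
    and ge: "ubar u v \<pi>0 \<le> subgame_payoff \<pi>0 u \<sigma>1 \<sigma>2 t1 t2 act"
  shows "subgame_payoff \<pi>0 v \<sigma>1 \<sigma>2 t1 t2 act = vbar v \<pi>0"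
proof -
  have cons: "consistent_beliefs \<pi>0 \<sigma>1 \<sigma>2 t1 t2 bel"
    and act: "\<And>m1 m2. act m1 m2 \<in> BR v (bel m1 m2)"
    using eq unfolding subgame_equilibrium_def by auto
  note bel = belief_in_prob_simplex[OF prior cons]
  obtain a where a: "point_mass a \<in> BR v \<pi>0"
    using ex_point_mass_BR by blast
  have aA: "a \<in> A_hat v"
    using A_hatI[OF a prior] .
  define P where "P m = (\<Sum>w\<in>UNIV. messages_prob \<pi>0 \<sigma>1 \<sigma>2 t1 t2 (fst m) (snd m) w)" for m
  have P: "0 \<le> P m" for m
    unfolding P_def by (intro sum_nonneg messages_prob_nonneg prior)
  have act_simplex: "\<And>m1 m2. act m1 m2 \<in> prob_simplex"
    using act by (auto simp: BR_def)
  note int_act = subgame_payoff_integral[where act = act and ?\<pi>0.0 = \<pi>0 and ?\<sigma>1.0 = \<sigma>1 and ?\<sigma>2.0 = \<sigma>2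
      and ?t1.0 = t1 and ?t2.0 = t2, OF act_simplex,
      unfolded messages_payoff_belief[OF prior cons], folded P_def]
  \<comment> \<open>The same messages and beliefs with \<open>a\<close> always played: the integral
    is then the payoff of \<open>a\<close> at the prior.\<close>
  note int_a = subgame_payoff_integral[where act = "\<lambda>_ _. point_mass a" and ?\<pi>0.0 = \<pi>0
      and ?\<sigma>1.0 = \<sigma>1 and ?\<sigma>2.0 = \<sigma>2 and ?t1.0 = t1 and ?t2.0 = t2, OF point_mass_in_prob_simplex,
      unfolded messages_payoff_belief[OF prior cons] subgame_payoff_const[OF \<sigma>], folded P_def]
  \<comment> \<open>The experts' gain from replacing the reply by \<open>a\<close>, weighted by the
    probability of the message pair.\<close>
  define d where "d m = P m * payoff u (point_mass a) (bel (fst m) (snd m))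
      - P m * payoff u (act (fst m) (snd m)) (bel (fst m) (snd m))" for m
  have u_act: "payoff u (act m1 m2) (bel m1 m2) = ubar u v (bel m1 m2)" for m1 m2
    by (rule payoff_BR_eq_ubar[OF dm conc bel act])
  have d_nn: "0 \<le> d m" for m
    using ubar_le_payoff[OF dm conc aA bel] P by (simp add: d_def u_act mult_left_mono)
  have d_int: "integrable (count_space UNIV) d"
    unfolding d_def by (intro Bochner_Integration.integrable_diff int_a int_act)
  have "integral\<^sup>L (count_space UNIV) d
      = payoff u (point_mass a) \<pi>0 - subgame_payoff \<pi>0 u \<sigma>1 \<sigma>2 t1 t2 act"
    unfolding d_def using int_a int_act by simp
  also have "\<dots> \<le> 0"
    using ge payoff_BR_eq_ubar[OF dm conc prior a] by simp
  finally have "integral\<^sup>L (count_space UNIV) d = 0"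
    using d_nn by (intro antisym Bochner_Integration.integral_nonneg)
  \<comment> \<open>Counting measure has no non-empty null sets, so almost everywhere means
    everywhere.\<close>
  then have d0: "d m = 0" for m
    using integral_nonneg_eq_0_iff_AE[OF d_int] d_nn by (cases m) (simp add: AE_count_space)
  have "(\<lambda>m. P m * payoff v (act (fst m) (snd m)) (bel (fst m) (snd m)))
      = (\<lambda>m. P m * payoff v (point_mass a) (bel (fst m) (snd m)))"
  proof (rule ext)
    fix m
    show "P m * payoff v (act (fst m) (snd m)) (bel (fst m) (snd m))
      = P m * payoff v (point_mass a) (bel (fst m) (snd m))"
    proof (cases "P m = 0")
      case False
      then have "payoff u (point_mass a) (bel (fst m) (snd m)) = ubar u v (bel (fst m) (snd m))"
        using d0[of m] by (simp add: d_def u_act)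
      then have "point_mass a \<in> BR v (bel (fst m) (snd m))"
        by (rule BR_if_payoff_eq_ubar[OF dm conc ex aA bel])
      then show ?thesis
        using payoff_BR act by metis
    qed simp
  qed
  then have "subgame_payoff \<pi>0 v \<sigma>1 \<sigma>2 t1 t2 act = payoff v (point_mass a) \<pi>0"
    by (simp only: int_act(2) int_a(2))
  with payoff_BR[OF a] show ?thesis
    by simp
qed

theorem proposition2:
  fixes \<pi>0 :: "real ^ 'w::finite"
    and u v :: "'a::finite \<Rightarrow> 'w \<Rightarrow> real"
  assumes prior: "\<pi>0 \<in> prob_simplex"
    and rich1: "\<forall>\<sigma>\<in>experiments. \<exists>enc :: 'w signal \<Rightarrow> 'm1. inj_on enc \<sigma>"
    and rich2: "\<forall>\<sigma>\<in>experiments. \<exists>enc :: 'w signal \<Rightarrow> 'm2. inj_on enc \<sigma>"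
    and experts: "no_redundant_experts u"
    and dm: "no_redundant_dm v"
    and concave: "concave_on prob_simplex (ubar u v)"
  shows "\<forall>\<sigma>1 (\<tau>1 :: ('w, 'm1) message_strategy) \<sigma>2 (\<tau>2 :: ('w, 'm2) message_strategy) \<alpha> \<mu>.
    equilibrium \<pi>0 u v \<sigma>1 \<tau>1 \<sigma>2 \<tau>2 \<alpha> \<mu> \<longrightarrow>
    subgame_payoff \<pi>0 v \<sigma>1 \<sigma>2 (\<tau>1 \<sigma>1 \<sigma>2) (\<tau>2 \<sigma>2 \<sigma>1) (\<alpha> \<sigma>1 \<sigma>2) = vbar v \<pi>0"
proof (intro allI impI)
  fix \<sigma>1 \<sigma>2 :: "'w stat_experiment"
    and \<tau>1 :: "('w, 'm1) message_strategy" and \<tau>2 :: "('w, 'm2) message_strategy" and \<alpha> \<mu>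
  let ?T = "{UNIV \<times> {0..1}} :: 'w stat_experiment"
  assume "equilibrium \<pi>0 u v \<sigma>1 \<tau>1 \<sigma>2 \<tau>2 \<alpha> \<mu>"
  then have \<sigma>: "\<sigma>1 \<in> experiments" "\<sigma>2 \<in> experiments"
    and sub: "\<And>\<rho>1 \<rho>2. \<rho>1 \<in> experiments \<Longrightarrow> \<rho>2 \<in> experiments \<Longrightarrow>
      subgame_equilibrium \<pi>0 u v \<rho>1 \<rho>2 (\<tau>1 \<rho>1 \<rho>2) (\<tau>2 \<rho>2 \<rho>1) (\<alpha> \<rho>1 \<rho>2) (\<mu> \<rho>1 \<rho>2)"
    and opt: "\<And>\<rho>1. \<rho>1 \<in> experiments \<Longrightarrow>
      subgame_payoff \<pi>0 u \<rho>1 \<sigma>2 (\<tau>1 \<rho>1 \<sigma>2) (\<tau>2 \<sigma>2 \<rho>1) (\<alpha> \<rho>1 \<sigma>2)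
        \<le> subgame_payoff \<pi>0 u \<sigma>1 \<sigma>2 (\<tau>1 \<sigma>1 \<sigma>2) (\<tau>2 \<sigma>2 \<sigma>1) (\<alpha> \<sigma>1 \<sigma>2)"
    unfolding equilibrium_def by auto
  \<comment> \<open>The sub-game after the deviation to the uninformative experiment is also in
    equilibrium; stage-one optimality carries its lower bound over to the chosen
    experiments.\<close>
  have "ubar u v \<pi>0
      \<le> subgame_payoff \<pi>0 u ?T \<sigma>2 (\<tau>1 ?T \<sigma>2) (\<tau>2 \<sigma>2 ?T) (\<alpha> ?T \<sigma>2)"
    by (rule ubar_le_subgame_payoff_trivial
        [OF prior dm concave \<sigma>(2) sub[OF trivial_experiment \<sigma>(2)]])
  also note opt[OF trivial_experiment]
  finally show "subgame_payoff \<pi>0 v \<sigma>1 \<sigma>2 (\<tau>1 \<sigma>1 \<sigma>2) (\<tau>2 \<sigma>2 \<sigma>1) (\<alpha> \<sigma>1 \<sigma>2) = vbar v \<pi>0"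
    by (rule dm_payoff_eq_vbar[OF prior dm concave experts \<sigma> sub[OF \<sigma>]])
qed

end
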